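(* Let $\chi$ be a character of $B_n$. If $\mathcal{B}$ and $\mathcal{B}'$ are finite sets endowed with maps $\mathrm{sDes}:\mathcal{B}\to\Sigma^B(n)$ and $\mathrm{sDes}:\mathcal{B}'\to\Sigma^B(n)$, both of which are fine sets for $\chi$, then $|\{b\in\mathcal{B}:\mathrm{sDes}(b)=\sigma\}|=|\{b\in\mathcal{B}':\mathrm{sDes}(b)=\sigma\}|$ for every $\sigma\in\Sigma^B(n)$; that is, the distribution of $\mathrm{sDes}$ over a fine set for $\chi$ is uniquely determined by $\chi$.
   Context: A signed set is a pair $\sigma=(S,\varepsilon)$ with $n\in S\subseteq[n]$ and $\varepsilon:S\to\{-,+\}$; $\Sigma^B(n)$ is the set of these; its sign vector is $\tilde\varepsilon(j)=\varepsilon(\min\{s\in S:s\ge j\})$ for $j\in[n]$. A signed composition of $n$ is a composition $(\gamma_1,\dots,\gamma_k)$ of $n$ with some parts barred; let $r_i=\gamma_1+\dots+\gamma_i$, $r_0=0$, $S(\gamma)=\{r_1,\dots,r_k\}$, $I_i=\{r_{i-1}+1,\dots,r_i\}$. The weight $\mathrm{wt}_\gamma(\sigma)$ is $0$ if for some $i$ the set $S\cap\{r_{i-1}+1,\dots,r_i-1\}$ is not an initial segment of $\{r_{i-1}+1,\dots,r_i-1\}$ or $\tilde\varepsilon$ is not constant on $I_i$; otherwise it is $(-1)^{|S\setminus S(\gamma)|+n_\gamma(\sigma)}$, where $n_\gamma(\sigma)$ is the number of $i$ with $\tilde\varepsilon=-$ on $I_i$ and $\gamma_i$ barred. For a class function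 $\chi$ on $B_n$, $\chi(\gamma)$ is its value at elements of signed cycle type $(\alpha,\beta)$, $\alpha$ (resp. $\beta$) the decreasing rearrangement of the unbarred (resp. barred) parts of $\gamma$ (the signed cycle type of $w\in B_n$, viewed as a permutation of $\{1,\dots,n,\bar1,\dots,\bar n\}$, records lengths of positive cycles — pairs of disjoint cycles $c,\bar c$ — and of negative cycles $c=\bar c$, the latter counted with half their length). A set $\mathcal B$ with a map $\mathrm{sDes}:\mathcal B\to\Sigma^B(n)$ is a fine set for $\chi$ if $\chi(\gamma)=\sum_{b\in\mathcal B}\mathrm{wt}_\gamma(\mathrm{sDes}(b))$ for all signed compositions $\gamma$ of $n$. *)

theory Defs
  imports Complex_Main "HOL-Library.FuncSet" "HOL-Library.Multiset"
    "HOL-Combinatorics.Permutations" "HOL-Combinatorics.Orbits"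
    "Jordan_Normal_Form.Matrix"
begin

subsection \<open>Signed sets\<close>

datatype sign = Minus | Plus

type_synonym signed_set = "nat set \<times> (nat \<Rightarrow> sign)"

text \<open>The sign map has domain \<open>S\<close>; it is made extensional so that equality of pairs is
  equality of signed sets.\<close>

definition signed_sets :: "nat \<Rightarrow> signed_set set" where
  "signed_sets n = {(S, \<epsilon>). n \<in> S \<and> S \<subseteq> {1..n} \<and> \<epsilon> \<in> S \<rightarrow>\<^sub>E UNIV}"

definition sign_vector :: "signed_set \<Rightarrow> nat \<Rightarrow> sign" where
  "sign_vector \<sigma> j = snd \<sigma> (Min {s \<in> fst \<sigma>. s \<ge> j})"

subsection \<open>Signed compositions and weights\<close>

text \<open>A part is a pair of its size and a flag telling whether it is barred.\<close>

type_synonym signed_composition = "(nat \<times> bool) list"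

definition signed_compositions :: "nat \<Rightarrow> signed_composition set" where
  "signed_compositions n = {\<gamma>. (\<forall>p \<in> set \<gamma>. fst p > 0) \<and> sum_list (map fst \<gamma>) = n}"

definition psum :: "signed_composition \<Rightarrow> nat \<Rightarrow> nat" where
  "psum \<gamma> i = sum_list (map fst (take i \<gamma>))"

text \<open>Blocks are numbered \<open>1, \<dots>, length \<gamma>\<close>, so that the \<open>i\<close>-th part is \<open>\<gamma> ! (i - 1)\<close>.\<close>

definition comp_set :: "signed_composition \<Rightarrow> nat set" where
  "comp_set \<gamma> = psum \<gamma> ` {1..length \<gamma>}"

definition block :: "signed_composition \<Rightarrow> nat \<Rightarrow> nat set" where
  "block \<gamma> i = {psum \<gamma> (i - 1) + 1..psum \<gamma> i}"

definition block_interior :: "signed_composition \<Rightarrow> nat \<Rightarrow> nat set" where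
  "block_interior \<gamma> i = {psum \<gamma> (i - 1) + 1..psum \<gamma> i - 1}"

definition barred :: "signed_composition \<Rightarrow> nat \<Rightarrow> bool" where
  "barred \<gamma> i = snd (\<gamma> ! (i - 1))"

definition initial_segment :: "nat set \<Rightarrow> nat set \<Rightarrow> bool" where
  "initial_segment T U \<longleftrightarrow> T \<subseteq> U \<and> (\<forall>x \<in> T. \<forall>y \<in> U. y \<le> x \<longrightarrow> y \<in> T)"

definition neg_barred_count :: "signed_composition \<Rightarrow> signed_set \<Rightarrow> nat" where
  "neg_barred_count \<gamma> \<sigma> =
     card {i \<in> {1..length \<gamma>}. (\<forall>j \<in> block \<gamma> i. sign_vector \<sigma> j = Minus) \<and> barred \<gamma> i}"

definition wt :: "signed_composition \<Rightarrow> signed_set \<Rightarrow> int" where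
  "wt \<gamma> \<sigma> =
     (if \<exists>i \<in> {1..length \<gamma>}.
           \<not> initial_segment (fst \<sigma> \<inter> block_interior \<gamma> i) (block_interior \<gamma> i) \<or>
           \<not> (\<exists>s. \<forall>j \<in> block \<gamma> i. sign_vector \<sigma> j = s)
      then 0
      else (-1) ^ (card (fst \<sigma> - comp_set \<gamma>) + neg_barred_count \<gamma> \<sigma>))"

subsection \<open>The hyperoctahedral group and its characters\<close>

text \<open>The barred letter \<open>\<bar>i\<close> is represented by the integer \<open>-i\<close>. Permutations are the
  identity outside the ground set, and the group operation is composition.\<close>

definition signed_letters :: "nat \<Rightarrow> int set" where
  "signed_letters n = {- int n..int n} - {0}"

definition hyperoctahedral :: "nat \<Rightarrow> (int \<Rightarrow> int) set" where
  "hyperoctahedral n =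
     {w. w permutes signed_letters n \<and> (\<forall>i \<in> signed_letters n. w (- i) = - w i)}"

definition is_representation :: "nat \<Rightarrow> nat \<Rightarrow> ((int \<Rightarrow> int) \<Rightarrow> complex mat) \<Rightarrow> bool" where
  "is_representation n d \<rho> \<longleftrightarrow>
     (\<forall>w \<in> hyperoctahedral n. \<rho> w \<in> carrier_mat d d) \<and>
     \<rho> id = 1\<^sub>m d \<and>
     (\<forall>u \<in> hyperoctahedral n. \<forall>v \<in> hyperoctahedral n. \<rho> (u \<circ> v) = \<rho> u * \<rho> v)"

definition mat_trace :: "complex mat \<Rightarrow> complex" where
  "mat_trace A = (\<Sum>i<dim_row A. A $$ (i, i))"

definition is_character :: "nat \<Rightarrow> ((int \<Rightarrow> int) \<Rightarrow> complex) \<Rightarrow> bool" where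
  "is_character n \<chi> \<longleftrightarrow>
     (\<exists>d \<rho>. is_representation n d \<rho> \<and> (\<forall>w \<in> hyperoctahedral n. \<chi> w = mat_trace (\<rho> w)))"

subsection \<open>Signed cycle types\<close>

text \<open>A cycle is identified with its set of letters. A positive cycle is a pair \<open>{c, \<bar>c}\<close> of
  disjoint cycles, of length \<open>card c\<close>, i.e. half the number of letters in \<open>c \<union> \<bar>c\<close>.\<close>

definition cycles_of :: "nat \<Rightarrow> (int \<Rightarrow> int) \<Rightarrow> int set set" where
  "cycles_of n w = orbit w ` signed_letters n"

definition positive_cycles :: "nat \<Rightarrow> (int \<Rightarrow> int) \<Rightarrow> int set set set" where
  "positive_cycles n w = {{c, uminus ` c} |c. c \<in> cycles_of n w \<and> c \<inter> uminus ` c = {}}"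

definition negative_cycles :: "nat \<Rightarrow> (int \<Rightarrow> int) \<Rightarrow> int set set" where
  "negative_cycles n w = {c \<in> cycles_of n w. c = uminus ` c}"

definition decreasing :: "nat multiset \<Rightarrow> nat list" where
  "decreasing M = rev (sorted_list_of_multiset M)"

definition signed_cycle_type :: "nat \<Rightarrow> (int \<Rightarrow> int) \<Rightarrow> nat list \<times> nat list" where
  "signed_cycle_type n w =
     (decreasing (image_mset (\<lambda>P. card (\<Union> P) div 2) (mset_set (positive_cycles n w))),
      decreasing (image_mset (\<lambda>c. card c div 2) (mset_set (negative_cycles n w))))"

definition composition_type :: "signed_composition \<Rightarrow> nat list \<times> nat list" where
  "composition_type \<gamma> =
     (decreasing (mset (map fst (filter (\<lambda>p. \<not> snd p) \<gamma>))),
      decreasing (mset (map fst (filter snd \<gamma>))))"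

subsection \<open>Fine sets\<close>

text \<open>The value \<open>\<chi>(\<gamma>)\<close> is \<open>\<chi> w\<close> for any \<open>w\<close> whose signed cycle type is that of \<open>\<gamma>\<close>.\<close>

definition fine_set ::
  "nat \<Rightarrow> ((int \<Rightarrow> int) \<Rightarrow> complex) \<Rightarrow> 'b set \<Rightarrow> ('b \<Rightarrow> signed_set) \<Rightarrow> bool" where
  "fine_set n \<chi> B sDes \<longleftrightarrow>
     sDes \<in> B \<rightarrow> signed_sets n \<and>
     (\<forall>\<gamma> \<in> signed_compositions n. \<forall>w \<in> hyperoctahedral n.
        signed_cycle_type n w = composition_type \<gamma> \<longrightarrow>
        \<chi> w = (\<Sum>b\<in>B. of_int (wt \<gamma> (sDes b))))"

end

theory Submission
  imports Defs
begin

text \<open>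
  A signed set of rank \<open>n\<close> is encoded as a word whose \<open>j\<close>-th letter records whether \<open>j \<in> S\<close> and
  the sign \<open>\<epsilon>~(j)\<close>. The weight of \<open>\<gamma>\<close> becomes a product of weights of consecutive factors of the
  word, and the sum and difference of a barred and an unbarred factor weight isolate the factors of
  one sign \<open>v\<close>. Let \<open>c\<close> be a function on signed sets that is orthogonal to all weights. Splitting off
  the first part of \<open>\<gamma>\<close> and using induction on \<open>n\<close> shows, with \<open>F\<close> the letter of sign \<open>v\<close> outside \<open>S\<close>,
  that replacing every letter of a prefix of constant sign \<open>v\<close> by \<open>F\<close> changes \<open>c\<close> only by a sign. If
  the prefix is a maximal run, the resulting word encodes no signed set, because \<open>S\<close> contains \<open>n\<close>
  and every position after which the sign changes; so \<open>c = 0\<close>. For the theorem, \<open>c\<close> is the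
  difference of the two distributions: it is orthogonal to all weights because every signed
  composition is the cycle type of some element of \<open>B\<^sub>n\<close>.
\<close>

subsection \<open>Words and their weights\<close>

lemma UNIV_sign: "UNIV = {Minus, Plus}"
  by (auto intro: sign.exhaust)

instance sign :: finite
  by standard (simp add: UNIV_sign)

definition words :: "nat \<Rightarrow> 'a list set" where
  "words n = {xs. length xs = n}"

lemma finite_words: "finite (words n :: 'a::finite list set)"
  using finite_lists_length_eq[of "UNIV :: 'a set" n] by (simp add: words_def)

lemma sum_words_append:
  "(\<Sum>xs\<in>words (m + k). f xs) = (\<Sum>u\<in>words m. \<Sum>y\<in>words k. f (u @ y))"
proof -
  have "(\<Sum>xs\<in>words (m + k). f xs) = (\<Sum>(u, y)\<in>words m \<times> words k. f (u @ y))"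
    by (rule sum.reindex_bij_witness[of _ "\<lambda>(u, y). u @ y" "\<lambda>xs. (take m xs, drop m xs)"])
      (auto simp: words_def)
  then show ?thesis
    by (simp add: sum.cartesian_product)
qed

lemma sum_words_Suc_snoc:
  "(\<Sum>xs\<in>words (Suc m). f xs) = (\<Sum>u\<in>words m. \<Sum>a\<in>UNIV. f (u @ [a]))"
proof -
  have "(\<Sum>xs\<in>words (Suc m). f xs) = (\<Sum>(u, a)\<in>words m \<times> UNIV. f (u @ [a]))"
    by (rule sum.reindex_bij_witness[of _ "\<lambda>(u, a). u @ [a]" "\<lambda>xs. (butlast xs, last xs)"])
      (auto simp: words_def append_butlast_last_id simp flip: length_greater_0_conv)
  then show ?thesis
    by (simp add: sum.cartesian_product)
qed

type_synonym word = "(bool \<times> sign) list"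

definition monochrome :: "sign \<Rightarrow> word \<Rightarrow> bool" where
  "monochrome v u \<longleftrightarrow> (\<forall>x\<in>set u. snd x = v)"

definition front_loaded :: "word \<Rightarrow> bool" where
  "front_loaded u \<longleftrightarrow> sorted_wrt (\<lambda>x y. fst y \<longrightarrow> fst x) u"

definition descent_sign :: "word \<Rightarrow> 'a::comm_ring_1" where
  "descent_sign u = (-1) ^ length (filter fst u)"

definition sign_block_wt :: "sign \<Rightarrow> word \<Rightarrow> 'a::comm_ring_1" where
  "sign_block_wt v u =
     (if monochrome v u \<and> front_loaded (butlast u) then descent_sign (butlast u) else 0)"

definition block_wt :: "bool \<Rightarrow> word \<Rightarrow> 'a::comm_ring_1" where
  "block_wt b u = sign_block_wt Plus u + (if b then -1 else 1) * sign_block_wt Minus u"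

fun word_wt :: "signed_composition \<Rightarrow> word \<Rightarrow> 'a::comm_ring_1" where
  "word_wt [] xs = 1"
| "word_wt (p # \<gamma>) xs = block_wt (snd p) (take (fst p) xs) * word_wt \<gamma> (drop (fst p) xs)"

definition weight_orthogonal :: "nat \<Rightarrow> (word \<Rightarrow> 'a::comm_ring_1) \<Rightarrow> bool" where
  "weight_orthogonal n c \<longleftrightarrow>
     (\<forall>\<gamma> \<in> signed_compositions n. (\<Sum>xs\<in>words n. word_wt \<gamma> xs * c xs) = 0)"

definition sign_block_orthogonal :: "nat \<Rightarrow> (word \<Rightarrow> 'a::comm_ring_1) \<Rightarrow> bool" where
  "sign_block_orthogonal n c \<longleftrightarrow>
     (\<forall>v m y. 0 < m \<longrightarrow> m + length y = n \<longrightarrow> (\<Sum>u\<in>words m. sign_block_wt v u * c (u @ y)) = 0)"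

lemma descent_sign_square: "descent_sign u * descent_sign u = 1"
  by (simp add: descent_sign_def flip: power_mult_distrib)

lemma monochrome_append [simp]: "monochrome v (u @ y) \<longleftrightarrow> monochrome v u \<and> monochrome v y"
  by (auto simp: monochrome_def)

lemma monochrome_Cons [simp]: "monochrome v (x # u) \<longleftrightarrow> snd x = v \<and> monochrome v u"
  by (simp add: monochrome_def)

lemma monochrome_Nil [simp]: "monochrome v []"
  by (simp add: monochrome_def)

lemma monochrome_unique: "monochrome v u \<Longrightarrow> monochrome v' u \<Longrightarrow> u \<noteq> [] \<Longrightarrow> v = v'"
  by (cases u) auto

lemma word_wt_eq_prod:
  "word_wt \<gamma> xs = (\<Prod>i<length \<gamma>. block_wt (snd (\<gamma> ! i)) (take (fst (\<gamma> ! i)) (drop (psum \<gamma> i) xs)))"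
proof (induction \<gamma> arbitrary: xs)
  case (Cons p \<gamma>)
  have "psum (p # \<gamma>) (Suc i) = psum \<gamma> i + fst p" for i
    by (simp add: psum_def)
  moreover have "psum (p # \<gamma>) 0 = 0"
    by (simp add: psum_def)
  ultimately show ?case
    by (simp add: Cons.IH prod.lessThan_Suc_shift del: prod.lessThan_Suc)
qed simp

lemma block_wt_nonempty:
  assumes "u \<noteq> []"
  shows "block_wt b u =
    (if (\<exists>v. monochrome v u) \<and> front_loaded (butlast u)
     then descent_sign (butlast u) * (if monochrome Minus u \<and> b then -1 else 1) else 0)"
proof (cases "\<exists>v. monochrome v u")
  case True
  then obtain v where v: "monochrome v u" ..
  then have "monochrome v' u \<longleftrightarrow> v' = v" for v'
    using monochrome_unique[OF _ v assms] by blast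
  then show ?thesis
    by (cases v) (simp_all add: block_wt_def sign_block_wt_def)
qed (simp add: block_wt_def sign_block_wt_def)

subsection \<open>Weights separate words\<close>

lemma weight_orthogonal_block_sum:
  fixes c :: "word \<Rightarrow> 'a::comm_ring_1"
  assumes "weight_orthogonal (m + k) c" and "m > 0"
  shows "weight_orthogonal k (\<lambda>y. \<Sum>u\<in>words m. block_wt b u * c (u @ y))"
  unfolding weight_orthogonal_def
proof
  fix \<gamma> assume "\<gamma> \<in> signed_compositions k"
  with \<open>m > 0\<close> have "(m, b) # \<gamma> \<in> signed_compositions (m + k)"
    by (simp add: signed_compositions_def)
  with assms(1) have "0 = (\<Sum>xs\<in>words (m + k). word_wt ((m, b) # \<gamma>) xs * c xs)"
    by (simp add: weight_orthogonal_def del: word_wt.simps)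
  also have "\<dots> = (\<Sum>u\<in>words m. \<Sum>y\<in>words k. word_wt \<gamma> y * (block_wt b u * c (u @ y)))"
    unfolding sum_words_append
    by (intro sum.cong refl) (auto simp: words_def)
  also have "\<dots> = (\<Sum>y\<in>words k. word_wt \<gamma> y * (\<Sum>u\<in>words m. block_wt b u * c (u @ y)))"
    by (subst sum.swap) (simp add: sum_distrib_left)
  finally show "(\<Sum>y\<in>words k. word_wt \<gamma> y * (\<Sum>u\<in>words m. block_wt b u * c (u @ y))) = 0" ..
qed

lemma sum_sign_block_wt_eq_0:
  fixes f :: "word \<Rightarrow> 'a::{idom, ring_char_0}"
  assumes "\<And>b. (\<Sum>u\<in>A. block_wt b u * f u) = 0"
  shows "(\<Sum>u\<in>A. sign_block_wt v u * f u) = 0"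
proof -
  let ?s = "\<lambda>v. \<Sum>u\<in>A. sign_block_wt v u * f u"
  have "(\<Sum>u\<in>A. block_wt b u * f u) = ?s Plus + (if b then -1 else 1) * ?s Minus" for b
    by (simp add: block_wt_def algebra_simps sum.distrib sum_subtractf sum_negf)
  then have plus: "?s Plus + ?s Minus = 0" and minus: "?s Plus - ?s Minus = 0"
    using assms[of False] assms[of True] by simp_all
  have "2 * ?s Plus = (?s Plus + ?s Minus) + (?s Plus - ?s Minus)"
    by simp
  then have "?s Plus = 0"
    unfolding plus minus by simp
  with plus show ?thesis
    by (cases v) simp_all
qed

lemma sum_sign_block_wt_Suc:
  "(\<Sum>u\<in>words (Suc m). sign_block_wt v u * f u) =
    (\<Sum>u | u \<in> words m \<and> monochrome v u \<and> front_loaded u.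
      descent_sign u * (f (u @ [(True, v)]) + f (u @ [(False, v)])))"
proof -
  have sum_UNIV: "(\<Sum>a\<in>UNIV. g a) =
      g (True, Plus) + g (True, Minus) + g (False, Plus) + g (False, Minus)"
    for g :: "bool \<times> sign \<Rightarrow> 'a"
    by (simp add: UNIV_bool UNIV_sign ac_simps flip: UNIV_Times_UNIV sum.cartesian_product)
  have "(\<Sum>a\<in>UNIV. sign_block_wt v (u @ [a]) * f (u @ [a])) =
      (if monochrome v u \<and> front_loaded u
       then descent_sign u * (f (u @ [(True, v)]) + f (u @ [(False, v)])) else 0)" for u
    unfolding sum_UNIV by (cases v) (auto simp: sign_block_wt_def distrib_left)
  then show ?thesis
    by (simp add: sum_words_Suc_snoc sum.inter_filter finite_words)
qed

lemma sign_block_wt_orthogonal_snoc: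
  fixes f :: "word \<Rightarrow> 'a::{idom, ring_char_0}"
  assumes "(\<Sum>u\<in>words (Suc m). sign_block_wt v u * f u) = 0"
    and "\<And>u t. u \<in> words m \<Longrightarrow> monochrome v u \<Longrightarrow> f (u @ [(t, v)]) = descent_sign u * d t"
  shows "d True = - d False"
proof -
  define U where "U = {u \<in> words m. monochrome v u \<and> front_loaded u}"
  have "replicate m (False, v) \<in> U"
    by (auto simp: U_def words_def monochrome_def front_loaded_def sorted_wrt_iff_nth_less)
  moreover have "finite U"
    by (simp add: U_def finite_words)
  ultimately have "card U \<noteq> 0"
    by auto
  have "0 = (\<Sum>u\<in>U. descent_sign u * (f (u @ [(True, v)]) + f (u @ [(False, v)])))"
    using assms(1) by (simp add: sum_sign_block_wt_Suc U_def)
  also have "\<dots> = (\<Sum>u\<in>U. d True + d False)"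
    by (intro sum.cong)
      (auto simp: assms(2) U_def descent_sign_square simp flip: distrib_left mult.assoc)
  finally have "of_nat (card U) * (d True + d False) = 0"
    by simp
  with \<open>card U \<noteq> 0\<close> show ?thesis
    by (simp add: eq_neg_iff_add_eq_0)
qed

lemma monochrome_prefix_straighten:
  fixes c :: "word \<Rightarrow> 'a::{idom, ring_char_0}"
  assumes "sign_block_orthogonal n c"
    and "monochrome v u" and "length u + length y = n"
  shows "c (u @ y) = descent_sign u * c (replicate (length u) (False, v) @ y)"
  using assms(2,3)
proof (induction "length u" arbitrary: u y)
  case 0
  then show ?case by (simp add: descent_sign_def)
next
  case (Suc m)
  define d where "d t = c (replicate m (False, v) @ (t, v) # y)" for t
  have pull: "c (u' @ (t, v) # y) = descent_sign u' * d t"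
    if "u' \<in> words m" "monochrome v u'" for u' t
    using Suc.hyps(1)[of u' "(t, v) # y"] Suc.hyps(2) Suc.prems that by (simp add: words_def d_def)
  have "(\<Sum>u\<in>words (Suc m). sign_block_wt v u * c (u @ y)) = 0"
    using assms(1) by (simp add: sign_block_orthogonal_def flip: Suc.hyps(2) Suc.prems(2))
  then have flip: "d True = - d False"
    by (rule sign_block_wt_orthogonal_snoc) (simp add: pull)
  obtain u' x where snoc: "u = u' @ [x]"
    using Suc.hyps(2) by (cases u rule: rev_cases) simp_all
  then obtain t where "x = (t, v)"
    using Suc.prems(1) by (cases x) simp
  with snoc have u: "u = u' @ [(t, v)]" and u': "u' \<in> words m" "monochrome v u'"
    using Suc.hyps(2) Suc.prems(1) by (simp_all add: words_def)
  have "c (u @ y) = descent_sign u' * d t"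
    using pull[OF u'] u by simp
  also have "\<dots> = descent_sign u * d False"
    using flip by (cases t) (simp_all add: u descent_sign_def)
  also have "d False = c (replicate (length u) (False, v) @ y)"
    by (simp add: d_def replicate_app_Cons_same flip: Suc.hyps(2))
  finally show ?case .
qed

definition valid :: "word \<Rightarrow> bool" where
  "valid xs \<longleftrightarrow> (\<forall>i<length xs.
     fst (xs ! i) \<or> (Suc i < length xs \<and> snd (xs ! Suc i) = snd (xs ! i)))"

lemma valid_appendD:
  assumes "valid (u @ y)"
  shows "valid y"
  unfolding valid_def
proof (intro allI impI)
  fix i assume "i < length y"
  then show "fst (y ! i) \<or> Suc i < length y \<and> snd (y ! Suc i) = snd (y ! i)"
    using assms[unfolded valid_def, rule_format, of "length u + i"] by (simp add: nth_append)
qed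

lemma not_valid_replicate_append:
  assumes "m > 0" and "y = [] \<or> snd (hd y) \<noteq> v"
  shows "\<not> valid (replicate m (False, v) @ y)"
proof
  assume "valid (replicate m (False, v) @ y)"
  then show False
    using assms unfolding valid_def
    by (auto dest!: spec[of _ "m - 1"] simp: nth_append hd_conv_nth)
qed

lemma sign_block_orthogonal_eq_0:
  fixes c :: "word \<Rightarrow> 'a::{idom, ring_char_0}"
  assumes supp: "\<And>xs. length xs = n \<Longrightarrow> \<not> valid xs \<Longrightarrow> c xs = 0"
    and orth: "sign_block_orthogonal n c"
    and xs: "length xs = n" "xs \<noteq> []"
  shows "c xs = 0"
proof -
  define v where "v = snd (hd xs)"
  define u where "u = takeWhile (\<lambda>x. snd x = v) xs"
  define y where "y = dropWhile (\<lambda>x. snd x = v) xs"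
  have split: "xs = u @ y" and "monochrome v u"
    by (auto simp: u_def y_def monochrome_def dest: set_takeWhileD)
  have "u \<noteq> []"
    using xs(2) by (cases xs) (simp_all add: u_def v_def)
  moreover have "y = [] \<or> snd (hd y) \<noteq> v"
    using hd_dropWhile[of "\<lambda>x. snd x = v" xs] by (auto simp: y_def)
  ultimately have "\<not> valid (replicate (length u) (False, v) @ y)"
    by (intro not_valid_replicate_append) simp_all
  then have "c (replicate (length u) (False, v) @ y) = 0"
    using xs(1) split by (intro supp) simp_all
  moreover have "c xs = descent_sign u * c (replicate (length u) (False, v) @ y)"
    using monochrome_prefix_straighten[OF orth \<open>monochrome v u\<close>] xs(1) split by simp
  ultimately show ?thesis
    by simp
qed

lemma word_wt_separates:
  fixes c :: "word \<Rightarrow> 'a::{idom, ring_char_0}"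
  assumes "\<And>xs. length xs = n \<Longrightarrow> \<not> valid xs \<Longrightarrow> c xs = 0"
    and "weight_orthogonal n c"
    and "length xs = n"
  shows "c xs = 0"
  using assms
proof (induction n arbitrary: c xs rule: less_induct)
  case (less n)
  have "(\<Sum>u\<in>words m. block_wt b u * c (u @ y)) = 0"
    if m: "m > 0" "m + length y = n" for m b y
  proof (rule less.IH[of "length y"])
    fix z :: word assume z: "length z = length y" "\<not> valid z"
    then have "c (u @ z) = 0" if "u \<in> words m" for u
      using that m by (intro less.prems(1)) (auto simp: words_def dest: valid_appendD)
    then show "(\<Sum>u\<in>words m. block_wt b u * c (u @ z)) = 0"
      by simp
  next
    show "weight_orthogonal (length y) (\<lambda>y. \<Sum>u\<in>words m. block_wt b u * c (u @ y))"
      using less.prems(2) m by (intro weight_orthogonal_block_sum) simp_all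
  qed (use m in simp_all)
  then have orth: "sign_block_orthogonal n c"
    by (simp add: sign_block_orthogonal_def sum_sign_block_wt_eq_0)
  show ?case
  proof (cases "xs = []")
    case True
    have "[] \<in> signed_compositions 0" "words 0 = {[] :: word}"
      by (auto simp: signed_compositions_def words_def)
    then show ?thesis
      using less.prems(2,3) True by (auto simp: weight_orthogonal_def)
  next
    case False
    with less.prems(1) orth less.prems(3) show ?thesis
      by (rule sign_block_orthogonal_eq_0)
  qed
qed

subsection \<open>Signed sets as words\<close>

definition segment :: "signed_set \<Rightarrow> nat \<Rightarrow> nat \<Rightarrow> word" where
  "segment \<sigma> a b = map (\<lambda>j. (j \<in> fst \<sigma>, sign_vector \<sigma> j)) [Suc a..<Suc b]"

abbreviation signed_word :: "nat \<Rightarrow> signed_set \<Rightarrow> word" where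
  "signed_word n \<sigma> \<equiv> segment \<sigma> 0 n"

lemma length_segment [simp]: "length (segment \<sigma> a b) = b - a"
  by (simp add: segment_def del: upt_Suc)

lemma nth_segment:
  "i < b - a \<Longrightarrow> segment \<sigma> a b ! i = (Suc (a + i) \<in> fst \<sigma>, sign_vector \<sigma> (Suc (a + i)))"
  by (simp add: segment_def del: upt_Suc)

lemma take_drop_segment:
  "a + l + m \<le> b \<Longrightarrow> take m (drop l (segment \<sigma> a b)) = segment \<sigma> (a + l) (a + l + m)"
  by (simp add: segment_def take_map drop_map del: upt_Suc)

lemma butlast_segment: "butlast (segment \<sigma> a b) = segment \<sigma> a (b - 1)"
  by (rule nth_equalityI) (auto simp: nth_segment nth_butlast)

lemma monochrome_segment:
  "monochrome v (segment \<sigma> a b) \<longleftrightarrow> (\<forall>j\<in>{a + 1..b}. sign_vector \<sigma> j = v)"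
  by (auto simp: monochrome_def segment_def simp del: upt_Suc)

lemma sorted_wrt_upt_iff:
  "sorted_wrt P [m..<n] \<longleftrightarrow> (\<forall>i j. m \<le> i \<longrightarrow> i < j \<longrightarrow> j < n \<longrightarrow> P i j)"
proof
  assume sorted: "sorted_wrt P [m..<n]"
  show "\<forall>i j. m \<le> i \<longrightarrow> i < j \<longrightarrow> j < n \<longrightarrow> P i j"
  proof (intro allI impI)
    fix i j assume "m \<le> i" "i < j" "j < n"
    then show "P i j"
      using sorted_wrt_nth_less[OF sorted, of "i - m" "j - m"] by simp
  qed
qed (simp add: sorted_wrt_iff_nth_less)

lemma front_loaded_segment:
  "front_loaded (segment \<sigma> a b) \<longleftrightarrow> initial_segment (fst \<sigma> \<inter> {a + 1..b}) {a + 1..b}"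
proof -
  have "front_loaded (segment \<sigma> a b) \<longleftrightarrow>
      (\<forall>y x. a < y \<longrightarrow> y < x \<longrightarrow> x \<le> b \<longrightarrow> x \<in> fst \<sigma> \<longrightarrow> y \<in> fst \<sigma>)"
    unfolding front_loaded_def segment_def sorted_wrt_map sorted_wrt_upt_iff
    by (simp only: fst_conv Suc_le_eq less_Suc_eq_le)
  also have "\<dots> \<longleftrightarrow> (\<forall>y x. a < y \<longrightarrow> y \<le> x \<longrightarrow> x \<le> b \<longrightarrow> x \<in> fst \<sigma> \<longrightarrow> y \<in> fst \<sigma>)"
    by (metis nat_less_le)
  also have "\<dots> \<longleftrightarrow> initial_segment (fst \<sigma> \<inter> {a + 1..b}) {a + 1..b}"
    by (fastforce simp: initial_segment_def Suc_le_eq)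
  finally show ?thesis .
qed

lemma descent_sign_segment:
  "descent_sign (segment \<sigma> a b) = (-1) ^ card (fst \<sigma> \<inter> {a + 1..b})"
proof -
  have "length (filter fst (segment \<sigma> a b)) = length (filter (\<lambda>j. j \<in> fst \<sigma>) [Suc a..<Suc b])"
    by (simp add: segment_def filter_map comp_def del: upt_Suc)
  also have "\<dots> = card (fst \<sigma> \<inter> {a + 1..b})"
    by (simp add: distinct_length_filter atLeastLessThanSuc_atLeastAtMost del: upt_Suc)
  finally show ?thesis
    by (simp add: descent_sign_def)
qed

lemma sign_vector_eq_snd:
  assumes "\<sigma> \<in> signed_sets n" and "j \<in> fst \<sigma>"
  shows "sign_vector \<sigma> j = snd \<sigma> j"
proof -
  have "fst \<sigma> \<subseteq> {1..n}"
    using assms(1) by (auto simp: signed_sets_def)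
  then have "finite (fst \<sigma>)"
    by (rule finite_subset) simp
  then have "Min {s \<in> fst \<sigma>. j \<le> s} = j"
    using assms(2) by (intro Min_eqI) auto
  then show ?thesis
    by (simp add: sign_vector_def)
qed

lemma sign_vector_Suc: "j \<notin> fst \<sigma> \<Longrightarrow> sign_vector \<sigma> (Suc j) = sign_vector \<sigma> j"
  unfolding sign_vector_def
  by (intro arg_cong[of _ _ "\<lambda>A. snd \<sigma> (Min A)"]) (auto simp: Suc_le_eq le_less)

lemma valid_signed_word:
  assumes "\<sigma> \<in> signed_sets n"
  shows "valid (signed_word n \<sigma>)"
proof -
  have "Suc i \<in> fst \<sigma> \<or> Suc i < n \<and> sign_vector \<sigma> (Suc (Suc i)) = sign_vector \<sigma> (Suc i)"
    if "i < n" for i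
  proof (cases "Suc i \<in> fst \<sigma>")
    case False
    moreover have "n \<in> fst \<sigma>"
      using assms by (auto simp: signed_sets_def)
    ultimately have "Suc i < n"
      using that by (metis Suc_lessI)
    then show ?thesis
      using False by (simp add: sign_vector_Suc)
  qed simp
  then show ?thesis
    by (fastforce simp: valid_def nth_segment)
qed

lemma inj_on_signed_word: "inj_on (signed_word n) (signed_sets n)"
proof (rule inj_onI)
  fix \<sigma> \<tau> assume \<sigma>: "\<sigma> \<in> signed_sets n" and \<tau>: "\<tau> \<in> signed_sets n"
    and eq: "signed_word n \<sigma> = signed_word n \<tau>"
  have letter: "(j \<in> fst \<sigma> \<longleftrightarrow> j \<in> fst \<tau>) \<and> sign_vector \<sigma> j = sign_vector \<tau> j" if "j \<in> {1..n}" for j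
    using arg_cong[OF eq, of "\<lambda>xs. xs ! (j - 1)"] that by (auto simp: nth_segment)
  have sub: "fst \<sigma> \<subseteq> {1..n}" "fst \<tau> \<subseteq> {1..n}"
    using \<sigma> \<tau> by (auto simp: signed_sets_def)
  then have fst_eq: "fst \<sigma> = fst \<tau>"
    using letter by blast
  moreover have "snd \<sigma> = snd \<tau>"
  proof (rule extensionalityI)
    show "snd \<sigma> \<in> extensional (fst \<sigma>)" "snd \<tau> \<in> extensional (fst \<sigma>)"
      using \<sigma> \<tau> fst_eq by (auto simp: signed_sets_def PiE_def)
    show "snd \<sigma> j = snd \<tau> j" if "j \<in> fst \<sigma>" for j
      using letter[of j] that sub fst_eq sign_vector_eq_snd[OF \<sigma>] sign_vector_eq_snd[OF \<tau>] by auto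
  qed
  ultimately show "\<sigma> = \<tau>"
    by (rule prod_eqI)
qed

subsection \<open>Weights of signed sets as weights of words\<close>

lemma psum_Suc: "i < length \<gamma> \<Longrightarrow> psum \<gamma> (Suc i) = psum \<gamma> i + fst (\<gamma> ! i)"
  by (simp add: psum_def take_Suc_conv_app_nth)

lemma psum_mono:
  assumes "i \<le> j"
  shows "psum \<gamma> i \<le> psum \<gamma> j"
proof -
  have "take j \<gamma> = take i \<gamma> @ take (j - i) (drop i \<gamma>)"
    using assms by (simp flip: take_add)
  then show ?thesis
    by (simp add: psum_def)
qed

lemma psum_length: "\<gamma> \<in> signed_compositions n \<Longrightarrow> psum \<gamma> (length \<gamma>) = n"
  by (simp add: psum_def signed_compositions_def)

lemma psum_pred_less:
  assumes "\<gamma> \<in> signed_compositions n" and "i \<in> {1..length \<gamma>}"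
  shows "psum \<gamma> (i - 1) < psum \<gamma> i"
  using assms by (cases i) (auto simp: psum_Suc signed_compositions_def)

lemma word_wt_signed_word:
  assumes "\<gamma> \<in> signed_compositions n"
  shows "word_wt \<gamma> (signed_word n \<sigma>) =
    (\<Prod>i\<in>{1..length \<gamma>}. block_wt (barred \<gamma> i) (segment \<sigma> (psum \<gamma> (i - 1)) (psum \<gamma> i)))"
proof -
  have "take (fst (\<gamma> ! i)) (drop (psum \<gamma> i) (signed_word n \<sigma>)) =
      segment \<sigma> (psum \<gamma> i) (psum \<gamma> (Suc i))" if "i < length \<gamma>" for i
    using take_drop_segment[of 0 "psum \<gamma> i" "fst (\<gamma> ! i)" n \<sigma>] that
      psum_mono[of "Suc i" "length \<gamma>" \<gamma>] psum_length[OF assms] by (simp add: psum_Suc)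
  then show ?thesis
    by (simp add: word_wt_eq_prod prod.atLeast1_atMost_eq barred_def)
qed

definition block_nonzero :: "signed_composition \<Rightarrow> signed_set \<Rightarrow> nat \<Rightarrow> bool" where
  "block_nonzero \<gamma> \<sigma> i \<longleftrightarrow>
     (\<exists>s. \<forall>j\<in>block \<gamma> i. sign_vector \<sigma> j = s) \<and>
     initial_segment (fst \<sigma> \<inter> block_interior \<gamma> i) (block_interior \<gamma> i)"

definition block_exponent :: "signed_composition \<Rightarrow> signed_set \<Rightarrow> nat \<Rightarrow> nat" where
  "block_exponent \<gamma> \<sigma> i = card (fst \<sigma> \<inter> block_interior \<gamma> i) +
     of_bool ((\<forall>j\<in>block \<gamma> i. sign_vector \<sigma> j = Minus) \<and> barred \<gamma> i)"

lemma block_wt_segment: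
  assumes "psum \<gamma> (i - 1) < psum \<gamma> i"
  shows "block_wt (barred \<gamma> i) (segment \<sigma> (psum \<gamma> (i - 1)) (psum \<gamma> i)) =
    (if block_nonzero \<gamma> \<sigma> i then (-1) ^ block_exponent \<gamma> \<sigma> i else 0)"
proof -
  have nonempty: "segment \<sigma> (psum \<gamma> (i - 1)) (psum \<gamma> i) \<noteq> []"
    using assms by (simp flip: length_greater_0_conv)
  show ?thesis
    unfolding block_wt_nonempty[OF nonempty] block_nonzero_def block_exponent_def block_def block_interior_def
      butlast_segment monochrome_segment front_loaded_segment descent_sign_segment
    by (intro if_cong) (simp_all add: power_add)
qed

lemma card_diff_psum_image:
  assumes \<gamma>: "\<gamma> \<in> signed_compositions n" and "k \<le> length \<gamma>"
  shows "card (S \<inter> {1..psum \<gamma> k} - psum \<gamma> ` {1..k}) =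
    (\<Sum>i\<in>{1..k}. card (S \<inter> block_interior \<gamma> i))"
  using assms(2)
proof (induction k)
  case 0
  then show ?case by (simp add: psum_def)
next
  case (Suc k)
  have less: "psum \<gamma> k < psum \<gamma> (Suc k)"
    using psum_pred_less[OF \<gamma>, of "Suc k"] Suc.prems by simp
  have le: "psum \<gamma> i \<le> psum \<gamma> k" if "i \<le> k" for i
    using that by (rule psum_mono)
  have split: "S \<inter> {1..psum \<gamma> (Suc k)} - psum \<gamma> ` {1..Suc k} =
      (S \<inter> {1..psum \<gamma> k} - psum \<gamma> ` {1..k}) \<union> (S \<inter> block_interior \<gamma> (Suc k))"
    using less le by (fastforce simp: block_interior_def atLeastAtMostSuc_conv)
  show ?case
    unfolding split using Suc
    by (subst card_Un_disjoint) (auto simp: block_interior_def)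
qed

lemma sum_block_exponent:
  assumes "\<gamma> \<in> signed_compositions n" and "fst \<sigma> \<subseteq> {1..n}"
  shows "(\<Sum>i\<in>{1..length \<gamma>}. block_exponent \<gamma> \<sigma> i) =
    card (fst \<sigma> - comp_set \<gamma>) + neg_barred_count \<gamma> \<sigma>"
proof -
  have "fst \<sigma> \<inter> {1..psum \<gamma> (length \<gamma>)} = fst \<sigma>"
    using assms(2) by (auto simp: psum_length[OF assms(1)])
  then show ?thesis
    using card_diff_psum_image[OF assms(1) order_refl, of "fst \<sigma>"]
    by (simp add: block_exponent_def sum.distrib comp_set_def neg_barred_count_def Int_def)
qed

lemma prod_if_zero:
  fixes f :: "'a \<Rightarrow> 'b::comm_semiring_1"
  assumes "finite A"
  shows "(\<Prod>i\<in>A. if P i then f i else 0) = (if \<forall>i\<in>A. P i then prod f A else 0)"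
  using assms by (induction A rule: finite_induct) auto

lemma of_int_wt_eq_word_wt:
  assumes \<gamma>: "\<gamma> \<in> signed_compositions n" and \<sigma>: "fst \<sigma> \<subseteq> {1..n}"
  shows "of_int (wt \<gamma> \<sigma>) = word_wt \<gamma> (signed_word n \<sigma>)"
proof -
  have "word_wt \<gamma> (signed_word n \<sigma>) =
      (\<Prod>i\<in>{1..length \<gamma>}. if block_nonzero \<gamma> \<sigma> i then (-1) ^ block_exponent \<gamma> \<sigma> i else 0)"
    unfolding word_wt_signed_word[OF \<gamma>]
  proof (rule prod.cong)
    fix i assume "i \<in> {1..length \<gamma>}"
    with \<gamma> have "psum \<gamma> (i - 1) < psum \<gamma> i"
      by (rule psum_pred_less)
    then show "block_wt (barred \<gamma> i) (segment \<sigma> (psum \<gamma> (i - 1)) (psum \<gamma> i)) =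
        (if block_nonzero \<gamma> \<sigma> i then (-1) ^ block_exponent \<gamma> \<sigma> i else 0)"
      by (rule block_wt_segment)
  qed simp
  also have "\<dots> = (if \<forall>i\<in>{1..length \<gamma>}. block_nonzero \<gamma> \<sigma> i
      then (-1) ^ (card (fst \<sigma> - comp_set \<gamma>) + neg_barred_count \<gamma> \<sigma>) else 0)"
    by (simp only: prod_if_zero finite_atLeastAtMost sum_block_exponent[OF \<gamma> \<sigma>] flip: power_sum)
  also have "\<dots> = of_int (wt \<gamma> \<sigma>)"
    by (auto simp: wt_def block_nonzero_def)
  finally show ?thesis ..
qed

lemma finite_signed_sets: "finite (signed_sets n)"
proof (rule inj_on_finite[OF inj_on_signed_word])
  show "signed_word n ` signed_sets n \<subseteq> words n"
    by (auto simp: words_def)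
qed (rule finite_words)

definition word_pushforward :: "nat \<Rightarrow> (signed_set \<Rightarrow> 'a::comm_ring_1) \<Rightarrow> word \<Rightarrow> 'a" where
  "word_pushforward n c xs = (\<Sum>\<tau> | \<tau> \<in> signed_sets n \<and> signed_word n \<tau> = xs. c \<tau>)"

lemma word_pushforward_not_valid:
  assumes "\<not> valid xs"
  shows "word_pushforward n c xs = 0"
proof -
  have "{\<tau> \<in> signed_sets n. signed_word n \<tau> = xs} = {}"
    using assms valid_signed_word by blast
  then show ?thesis
    unfolding word_pushforward_def by (metis sum.empty)
qed

lemma word_pushforward_signed_word:
  assumes "\<sigma> \<in> signed_sets n"
  shows "word_pushforward n c (signed_word n \<sigma>) = c \<sigma>"
proof -
  have "{\<tau> \<in> signed_sets n. signed_word n \<tau> = signed_word n \<sigma>} = {\<sigma>}"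
    using assms inj_on_signed_word by (auto dest: inj_onD)
  then show ?thesis
    by (simp add: word_pushforward_def)
qed

lemma sum_word_wt_word_pushforward:
  assumes "\<gamma> \<in> signed_compositions n"
  shows "(\<Sum>xs\<in>words n. word_wt \<gamma> xs * word_pushforward n c xs) =
    (\<Sum>\<sigma>\<in>signed_sets n. of_int (wt \<gamma> \<sigma>) * c \<sigma>)"
proof -
  have "(\<Sum>xs\<in>words n. word_wt \<gamma> xs * word_pushforward n c xs) = (\<Sum>xs\<in>words n.
      \<Sum>\<tau> | \<tau> \<in> signed_sets n \<and> signed_word n \<tau> = xs. word_wt \<gamma> (signed_word n \<tau>) * c \<tau>)"
    by (simp add: word_pushforward_def sum_distrib_left)
  also have "\<dots> = (\<Sum>\<tau>\<in>signed_sets n. word_wt \<gamma> (signed_word n \<tau>) * c \<tau>)"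
    by (rule sum.group[OF finite_signed_sets finite_words]) (auto simp: words_def)
  also have "\<dots> = (\<Sum>\<tau>\<in>signed_sets n. of_int (wt \<gamma> \<tau>) * c \<tau>)"
    using assms by (intro sum.cong refl) (auto simp: of_int_wt_eq_word_wt signed_sets_def)
  finally show ?thesis .
qed

lemma wt_separates_signed_sets:
  fixes c :: "signed_set \<Rightarrow> 'a::{idom, ring_char_0}"
  assumes "\<And>\<gamma>. \<gamma> \<in> signed_compositions n \<Longrightarrow>
      (\<Sum>\<sigma>\<in>signed_sets n. of_int (wt \<gamma> \<sigma>) * c \<sigma>) = 0"
    and "\<sigma> \<in> signed_sets n"
  shows "c \<sigma> = 0"
proof -
  have "weight_orthogonal n (word_pushforward n c)"
    by (simp add: weight_orthogonal_def sum_word_wt_word_pushforward assms(1))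
  with word_pushforward_not_valid have "word_pushforward n c (signed_word n \<sigma>) = 0"
    by (rule word_wt_separates) simp_all
  then show ?thesis
    using assms(2) by (simp add: word_pushforward_signed_word)
qed

subsection \<open>Elements with prescribed signed cycle type\<close>

abbreviation symmetrize :: "int set \<Rightarrow> int set" where
  "symmetrize A \<equiv> A \<union> uminus ` A"

lemma finite_signed_letters: "finite (signed_letters n)"
  by (simp add: signed_letters_def)

lemma signed_letters_add:
  "signed_letters (n + m) = signed_letters n \<union> symmetrize {int n + 1..int (n + m)}"
  by (auto simp: signed_letters_def)

lemma signed_letters_disjoint_symmetrize:
  "signed_letters n \<inter> symmetrize {int n + 1..k} = {}"
  by (auto simp: signed_letters_def)

lemma hyperoctahedral_permutes: "w \<in> hyperoctahedral n \<Longrightarrow> w permutes signed_letters n"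
  by (simp add: hyperoctahedral_def)

lemma hyperoctahedral_uminus:
  assumes "w \<in> hyperoctahedral n"
  shows "w (- x) = - w x"
proof (cases "x \<in> signed_letters n")
  case False
  then have "- x \<notin> signed_letters n"
    by (auto simp: signed_letters_def)
  with False show ?thesis
    using hyperoctahedral_permutes[OF assms] by (simp add: permutes_not_in)
qed (use assms in \<open>simp add: hyperoctahedral_def\<close>)

lemma orbit_uminus:
  fixes f :: "'a::group_add \<Rightarrow> 'a"
  assumes "\<And>x. f (- x) = - f x"
  shows "orbit f (- x) = uminus ` orbit f x"
proof -
  have "(f ^^ k) (- x) = - (f ^^ k) x" for k
    by (induction k) (simp_all add: assms)
  then show ?thesis
    by (auto simp: orbit_altdef)
qed

lemma orbit_subset_invariant:
  assumes "x \<in> A" and "f ` A \<subseteq> A"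
  shows "orbit f x \<subseteq> A"
proof
  fix y assume "y \<in> orbit f x"
  then show "y \<in> A"
    using assms by induction auto
qed

lemma orbit_eq_of_mem:
  assumes "f permutes A" and "finite A" and "y \<in> orbit f x"
  shows "orbit f y = orbit f x"
  using orbit_cyclic_eq3[OF cyclic_on_orbit[OF assms(1,2)] assms(3)] .

lemma orbits_comp_disjoint:
  assumes f: "f permutes A" "finite A" and g: "g permutes B" "finite B" and disj: "A \<inter> B = {}"
  shows "orbit (f \<circ> g) ` (A \<union> B) = orbit f ` A \<union> orbit g ` B"
proof -
  have "orbit (f \<circ> g) x = orbit f x" if "x \<in> A" for x
  proof (rule orbit_cyclic_eq3)
    show "cyclic_on (f \<circ> g) (orbit f x)"
      using g(1) cyclic_on_orbit[OF f] disj permutes_orbit_subset[OF f(1) that]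
      by (rule permutes_comp_preserves_cyclic1)
    show "x \<in> orbit f x"
      using f by (metis permutation_permutes permutation_self_in_orbit)
  qed
  moreover have "orbit (f \<circ> g) x = orbit g x" if "x \<in> B" for x
  proof (rule orbit_cyclic_eq3)
    show "cyclic_on (f \<circ> g) (orbit g x)"
      using f(1) cyclic_on_orbit[OF g] disj permutes_orbit_subset[OF g(1) that]
      by (rule permutes_comp_preserves_cyclic2)
    show "x \<in> orbit g x"
      using g by (metis permutation_permutes permutation_self_in_orbit)
  qed
  ultimately show ?thesis
    by (simp add: image_Un)
qed

text \<open>The closing step \<open>h \<mapsto> - l\<close>, taken if \<open>b\<close>, merges the cycle \<open>l, \<dots>, h\<close> and its mirror
  image into a single negative cycle.\<close>

definition signed_cycle :: "int \<Rightarrow> int \<Rightarrow> bool \<Rightarrow> int \<Rightarrow> int" where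
  "signed_cycle l h b x =
     (if \<bar>x\<bar> \<notin> {l..h} then x
      else if \<bar>x\<bar> < h then x + sgn x
      else (if b then - sgn x else sgn x) * l)"

lemma signed_cycle_uminus: "signed_cycle l h b (- x) = - signed_cycle l h b x"
  by (simp add: signed_cycle_def)

lemma mem_symmetrize_atLeastAtMost: "0 < l \<Longrightarrow> x \<in> symmetrize {l..h} \<longleftrightarrow> \<bar>x\<bar> \<in> {l..h}"
  by auto

lemma signed_cycle_permutes:
  assumes "0 < l"
  shows "signed_cycle l h b permutes symmetrize {l..h}"
proof (rule inj_imp_permutes)
  have abs_eq: "\<bar>signed_cycle l h b x\<bar> = (if \<bar>x\<bar> < h then \<bar>x\<bar> + 1 else l)"
    if "\<bar>x\<bar> \<in> {l..h}" for x
    using assms that by (auto simp: signed_cycle_def sgn_if)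
  show "inj_on (signed_cycle l h b) (symmetrize {l..h})"
  proof (rule inj_onI, unfold mem_symmetrize_atLeastAtMost[OF assms])
    fix x y assume x: "\<bar>x\<bar> \<in> {l..h}" and y: "\<bar>y\<bar> \<in> {l..h}"
      and eq: "signed_cycle l h b x = signed_cycle l h b y"
    have "\<bar>x\<bar> = \<bar>y\<bar>"
      using arg_cong[OF eq, of abs] x y unfolding abs_eq[OF x] abs_eq[OF y]
      by (auto split: if_splits)
    moreover have "x \<noteq> - y"
      using eq abs_eq[OF y] y assms signed_cycle_uminus[of l h b y] by (auto split: if_splits)
    ultimately show "x = y"
      by (simp add: abs_eq_iff)
  qed
  show "signed_cycle l h b x \<in> symmetrize {l..h}" if "x \<in> symmetrize {l..h}" for x
    using assms that unfolding mem_symmetrize_atLeastAtMost[OF assms]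
    by (auto simp: signed_cycle_def sgn_if)
  show "signed_cycle l h b x = x" if "x \<notin> symmetrize {l..h}" for x
    using that unfolding mem_symmetrize_atLeastAtMost[OF assms] by (simp add: signed_cycle_def)
qed simp

lemma interval_subset_orbit_signed_cycle:
  assumes "0 < l"
  shows "{l..h} \<subseteq> orbit (signed_cycle l h b) l"
proof
  fix x assume "x \<in> {l..h}"
  then have "l \<le> x" "x \<le> h"
    by simp_all
  then show "x \<in> orbit (signed_cycle l h b) l"
  proof (induction x rule: int_ge_induct)
    case base
    have "permutation (signed_cycle l h b)"
      using signed_cycle_permutes[OF assms] by (rule permutes_imp_permutation[rotated]) simp
    then show ?case
      by (rule permutation_self_in_orbit)
  next
    case (step i)
    then have "signed_cycle l h b i = i + 1"
      using assms by (simp add: signed_cycle_def)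
    with step show ?case
      using orbit.step[of i "signed_cycle l h b" l] by simp
  qed
qed

lemma orbit_signed_cycle:
  assumes "0 < l" and "l \<le> h"
  shows "orbit (signed_cycle l h b) l = (if b then symmetrize {l..h} else {l..h})"
proof (cases b)
  case False
  then have "signed_cycle l h b ` {l..h} \<subseteq> {l..h}"
    using assms by (auto simp: signed_cycle_def)
  then have "orbit (signed_cycle l h b) l \<subseteq> {l..h}"
    using assms by (intro orbit_subset_invariant) simp_all
  then show ?thesis
    using False interval_subset_orbit_signed_cycle[OF assms(1)] by auto
next
  case True
  let ?O = "orbit (signed_cycle l h b)"
  have up: "{l..h} \<subseteq> ?O l"
    using assms(1) by (rule interval_subset_orbit_signed_cycle)
  then have "h \<in> ?O l"
    using assms(2) by auto
  then have "signed_cycle l h b h \<in> ?O l"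
    by (rule orbit.step)
  also have "signed_cycle l h b h = - l"
    using assms True by (simp add: signed_cycle_def)
  finally have "?O (- l) = ?O l"
    by (rule orbit_eq_of_mem[OF signed_cycle_permutes[OF assms(1)], rotated]) simp
  then have "uminus ` ?O l = ?O l"
    by (simp add: orbit_uminus signed_cycle_uminus)
  with up have "symmetrize {l..h} \<subseteq> ?O l"
    by (metis Un_subset_iff image_mono)
  moreover have "?O l \<subseteq> symmetrize {l..h}"
    using assms by (intro permutes_orbit_subset signed_cycle_permutes) simp_all
  ultimately have "?O l = symmetrize {l..h}"
    by (intro subset_antisym)
  then show ?thesis
    using True by simp
qed

lemma orbits_signed_cycle:
  assumes "0 < l" and "l \<le> h"
  shows "orbit (signed_cycle l h b) ` symmetrize {l..h} =
    (if b then {symmetrize {l..h}} else {{l..h}, uminus ` {l..h}})"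
proof -
  let ?O = "orbit (signed_cycle l h b)"
  have "?O x = ?O l" if "x \<in> ?O l" for x
    by (rule orbit_eq_of_mem[OF signed_cycle_permutes[OF assms(1)] _ that]) simp
  then have "?O x = ?O l" if "x \<in> {l..h}" for x
    using that interval_subset_orbit_signed_cycle[OF assms(1)] by blast
  then have "?O ` {l..h} = (\<lambda>_. ?O l) ` {l..h}"
    by (rule image_cong[OF refl])
  with assms(2) have "?O ` {l..h} = {?O l}"
    by (simp add: image_constant_conv)
  moreover have "?O ` uminus ` {l..h} = (`) uminus ` ?O ` {l..h}"
    by (simp add: image_image orbit_uminus signed_cycle_uminus del: image_uminus_atLeastAtMost)
  ultimately have "?O ` symmetrize {l..h} = {?O l, uminus ` ?O l}"
    by (simp add: image_Un insert_commute del: image_uminus_atLeastAtMost)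
  then show ?thesis
    by (simp add: orbit_signed_cycle[OF assms] image_Un image_image Un_commute
        del: image_uminus_atLeastAtMost)
qed

lemma comp_signed_cycle_hyperoctahedral:
  assumes w: "w \<in> hyperoctahedral n"
  shows "w \<circ> signed_cycle (int n + 1) (int (n + m)) b \<in> hyperoctahedral (n + m)"
proof -
  have "w permutes signed_letters (n + m)"
    using hyperoctahedral_permutes[OF w] by (rule permutes_subset) (simp add: signed_letters_add)
  moreover have "signed_cycle (int n + 1) (int (n + m)) b permutes signed_letters (n + m)"
    by (rule permutes_subset[OF signed_cycle_permutes]) (simp_all add: signed_letters_add)
  ultimately show ?thesis
    by (simp add: hyperoctahedral_def permutes_compose signed_cycle_uminus
        hyperoctahedral_uminus[OF w])
qed

lemma cycles_of_comp_signed_cycle: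
  assumes "w \<in> hyperoctahedral n" and "0 < m"
  defines "A \<equiv> {int n + 1..int (n + m)}"
  shows "cycles_of (n + m) (w \<circ> signed_cycle (int n + 1) (int (n + m)) b) =
    cycles_of n w \<union> (if b then {symmetrize A} else {A, uminus ` A})"
proof -
  let ?z = "signed_cycle (int n + 1) (int (n + m)) b"
  have "cycles_of (n + m) (w \<circ> ?z) = orbit (w \<circ> ?z) ` (signed_letters n \<union> symmetrize A)"
    by (simp only: cycles_of_def signed_letters_add A_def)
  also have "\<dots> = orbit w ` signed_letters n \<union> orbit ?z ` symmetrize A"
    unfolding A_def using assms(1)
    by (intro orbits_comp_disjoint hyperoctahedral_permutes finite_signed_letters
        signed_cycle_permutes signed_letters_disjoint_symmetrize) simp_all
  also have "orbit ?z ` symmetrize A = (if b then {symmetrize A} else {A, uminus ` A})"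
    unfolding A_def using assms(2) by (intro orbits_signed_cycle) simp_all
  finally show ?thesis
    by (simp only: cycles_of_def)
qed

definition positive_lengths :: "nat \<Rightarrow> (int \<Rightarrow> int) \<Rightarrow> nat multiset" where
  "positive_lengths n w = image_mset (\<lambda>P. card (\<Union> P) div 2) (mset_set (positive_cycles n w))"

definition negative_lengths :: "nat \<Rightarrow> (int \<Rightarrow> int) \<Rightarrow> nat multiset" where
  "negative_lengths n w = image_mset (\<lambda>c. card c div 2) (mset_set (negative_cycles n w))"

lemma positive_cycles_eq_image:
  "positive_cycles n w = (\<lambda>c. {c, uminus ` c}) ` {c \<in> cycles_of n w. c \<inter> uminus ` c = {}}"
  by (auto simp: positive_cycles_def)

lemma finite_positive_cycles: "finite (positive_cycles n w)"
  by (simp add: positive_cycles_eq_image cycles_of_def finite_signed_letters)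

lemma finite_negative_cycles: "finite (negative_cycles n w)"
  by (simp add: negative_cycles_def cycles_of_def finite_signed_letters)

lemma cycle_subset_signed_letters:
  "w \<in> hyperoctahedral n \<Longrightarrow> c \<in> cycles_of n w \<Longrightarrow> c \<subseteq> signed_letters n"
  using permutes_orbit_subset[OF hyperoctahedral_permutes] by (auto simp: cycles_of_def)

lemma uminus_uminus_image [simp]: "uminus ` uminus ` (A :: 'a::group_add set) = A"
  by (simp add: image_image)

lemma lengths_insert_negative_cycle:
  assumes "cycles_of n' w' = cycles_of n w \<union> {C}" and "C \<notin> cycles_of n w"
    and "uminus ` C = C" and "C \<noteq> {}"
  shows "positive_lengths n' w' = positive_lengths n w"
    and "negative_lengths n' w' = add_mset (card C div 2) (negative_lengths n w)"
proof -
  have "positive_cycles n' w' = positive_cycles n w"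
    using assms by (auto simp: positive_cycles_def)
  then show "positive_lengths n' w' = positive_lengths n w"
    by (simp add: positive_lengths_def)
  have "negative_cycles n' w' = insert C (negative_cycles n w)" "C \<notin> negative_cycles n w"
    using assms by (auto simp: negative_cycles_def)
  then show "negative_lengths n' w' = add_mset (card C div 2) (negative_lengths n w)"
    by (simp add: negative_lengths_def finite_negative_cycles)
qed

lemma lengths_insert_positive_cycle:
  assumes "cycles_of n' w' = cycles_of n w \<union> {C, uminus ` C}"
    and "C \<notin> cycles_of n w" and "uminus ` C \<notin> cycles_of n w"
    and "C \<inter> uminus ` C = {}" and "C \<noteq> {}"
  shows "positive_lengths n' w' = add_mset (card (symmetrize C) div 2) (positive_lengths n w)"
    and "negative_lengths n' w' = negative_lengths n w"
proof -
  have "- x \<notin> C" if "x \<in> C" for x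
    using assms(4) imageI[of "- x" C uminus] that by auto
  then have "{c \<in> cycles_of n' w'. c \<inter> uminus ` c = {}} =
      {C, uminus ` C} \<union> {c \<in> cycles_of n w. c \<inter> uminus ` c = {}}"
    by (auto simp: assms(1))
  then have "positive_cycles n' w' = insert {C, uminus ` C} (positive_cycles n w)"
    by (simp add: positive_cycles_eq_image insert_commute)
  moreover have "{C, uminus ` C} \<notin> positive_cycles n w"
  proof
    assume "{C, uminus ` C} \<in> positive_cycles n w"
    then obtain c where "c \<in> cycles_of n w" "{C, uminus ` C} = {c, uminus ` c}"
      by (auto simp: positive_cycles_def)
    then show False
      using assms(2,3) by (metis insert_iff empty_iff)
  qed
  ultimately show "positive_lengths n' w' =
      add_mset (card (symmetrize C) div 2) (positive_lengths n w)"
    by (simp add: positive_lengths_def finite_positive_cycles)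
  have "C \<noteq> uminus ` C"
    using assms(4,5) by auto
  then have "negative_cycles n' w' = negative_cycles n w"
    by (auto simp: negative_cycles_def assms(1))
  then show "negative_lengths n' w' = negative_lengths n w"
    by (simp add: negative_lengths_def)
qed

lemma lengths_comp_signed_cycle:
  assumes w: "w \<in> hyperoctahedral n" and m: "0 < m"
  defines "z \<equiv> signed_cycle (int n + 1) (int (n + m))"
  shows "positive_lengths (n + m) (w \<circ> z False) = add_mset m (positive_lengths n w)"
    and "negative_lengths (n + m) (w \<circ> z False) = negative_lengths n w"
    and "positive_lengths (n + m) (w \<circ> z True) = positive_lengths n w"
    and "negative_lengths (n + m) (w \<circ> z True) = add_mset m (negative_lengths n w)"
proof -
  define A where "A = {int n + 1..int (n + m)}"
  have "A \<noteq> {}" and disj: "A \<inter> uminus ` A = {}"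
    using m by (auto simp: A_def)
  have card: "card (symmetrize A) = 2 * m"
    using disj by (subst card_Un_disjoint) (auto simp: A_def card_image)
  have new: "C \<notin> cycles_of n w" if "C \<subseteq> symmetrize A" "C \<noteq> {}" for C
    using that cycle_subset_signed_letters[OF w, of C]
      signed_letters_disjoint_symmetrize[of n "int (n + m)"] by (auto simp: A_def)
  note cycles = cycles_of_comp_signed_cycle[OF w m, folded z_def A_def]
  show "positive_lengths (n + m) (w \<circ> z False) = add_mset m (positive_lengths n w)"
      "negative_lengths (n + m) (w \<circ> z False) = negative_lengths n w"
    using lengths_insert_positive_cycle[of "n + m" "w \<circ> z False" n w A] cycles[of False]
      new[of A] new[of "uminus ` A"] disj \<open>A \<noteq> {}\<close> card by simp_all
  show "positive_lengths (n + m) (w \<circ> z True) = positive_lengths n w"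
      "negative_lengths (n + m) (w \<circ> z True) = add_mset m (negative_lengths n w)"
    using lengths_insert_negative_cycle[of "n + m" "w \<circ> z True" n w "symmetrize A"] cycles[of True]
      new[of "symmetrize A"] \<open>A \<noteq> {}\<close> card by (simp_all add: image_Un Un_commute)
qed

lemma exists_cycle_lengths:
  assumes "\<gamma> \<in> signed_compositions n"
  shows "\<exists>w \<in> hyperoctahedral n.
    positive_lengths n w = mset (map fst (filter (\<lambda>p. \<not> snd p) \<gamma>)) \<and>
    negative_lengths n w = mset (map fst (filter snd \<gamma>))"
  using assms
proof (induction \<gamma> arbitrary: n)
  case Nil
  then have "signed_letters n = {}"
    by (auto simp: signed_letters_def signed_compositions_def)
  then show ?case
    by (intro bexI[of _ id])
      (auto simp: hyperoctahedral_def positive_lengths_def negative_lengths_def positive_cycles_def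
        negative_cycles_def cycles_of_def permutes_def)
next
  case (Cons p \<gamma>)
  obtain m b where p: "p = (m, b)"
    by fastforce
  define k where "k = sum_list (map fst \<gamma>)"
  have m: "0 < m" and n: "n = k + m" and "\<gamma> \<in> signed_compositions k"
    using Cons.prems by (auto simp: signed_compositions_def p k_def)
  then obtain w where w: "w \<in> hyperoctahedral k"
    and pos: "positive_lengths k w = mset (map fst (filter (\<lambda>p. \<not> snd p) \<gamma>))"
    and neg: "negative_lengths k w = mset (map fst (filter snd \<gamma>))"
    using Cons.IH by blast
  show ?case
    unfolding n p
    by (rule bexI[OF _ comp_signed_cycle_hyperoctahedral[OF w, of m b]], cases b)
      (simp_all only: lengths_comp_signed_cycle[OF w m] pos neg, simp_all)
qed

lemma exists_signed_cycle_type: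
  assumes "\<gamma> \<in> signed_compositions n"
  shows "\<exists>w \<in> hyperoctahedral n. signed_cycle_type n w = composition_type \<gamma>"
  using exists_cycle_lengths[OF assms]
  unfolding signed_cycle_type_def composition_type_def positive_lengths_def negative_lengths_def
  by metis

subsection \<open>Uniqueness of the distribution\<close>

lemma sum_comp_eq_sum_card_fibers:
  fixes g :: "'b \<Rightarrow> 'c::comm_semiring_1"
  assumes "finite B" and "finite X" and "f \<in> B \<rightarrow> X"
  shows "(\<Sum>b\<in>B. g (f b)) = (\<Sum>x\<in>X. g x * of_nat (card {b \<in> B. f b = x}))"
proof -
  have "(\<Sum>b\<in>B. g (f b)) = (\<Sum>x\<in>X. \<Sum>b | b \<in> B \<and> f b = x. g (f b))"
    using assms by (intro sum.group[symmetric]) auto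
  also have "\<dots> = (\<Sum>x\<in>X. g x * of_nat (card {b \<in> B. f b = x}))"
    by (simp add: mult.commute)
  finally show ?thesis .
qed

lemma weights_determine_distribution:
  assumes "finite B" and "finite B'" and f: "f \<in> B \<rightarrow> signed_sets n" and f': "f' \<in> B' \<rightarrow> signed_sets n"
    and wt_eq: "\<And>\<gamma>. \<gamma> \<in> signed_compositions n \<Longrightarrow> (\<Sum>b\<in>B. wt \<gamma> (f b)) = (\<Sum>b\<in>B'. wt \<gamma> (f' b))"
    and "\<sigma> \<in> signed_sets n"
  shows "card {b \<in> B. f b = \<sigma>} = card {b \<in> B'. f' b = \<sigma>}"
proof -
  define c where "c \<sigma> = int (card {b \<in> B. f b = \<sigma>}) - int (card {b \<in> B'. f' b = \<sigma>})" for \<sigma>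
  have "(\<Sum>\<sigma>\<in>signed_sets n. of_int (wt \<gamma> \<sigma>) * c \<sigma>) = 0" if "\<gamma> \<in> signed_compositions n" for \<gamma>
    using wt_eq[OF that]
      sum_comp_eq_sum_card_fibers[OF assms(1) finite_signed_sets f, of "wt \<gamma>"]
      sum_comp_eq_sum_card_fibers[OF assms(2) finite_signed_sets f', of "wt \<gamma>"]
    by (simp add: c_def right_diff_distrib sum_subtractf)
  then have "c \<sigma> = 0"
    using assms(6) by (rule wt_separates_signed_sets)
  then show ?thesis
    by (simp add: c_def)
qed

lemma fine_set_sum_wt:
  assumes "fine_set n \<chi> B sDes" and "\<gamma> \<in> signed_compositions n"
    and "w \<in> hyperoctahedral n" and "signed_cycle_type n w = composition_type \<gamma>"
  shows "of_int (\<Sum>b\<in>B. wt \<gamma> (sDes b)) = \<chi> w"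
  using assms by (simp add: fine_set_def)

theorem theorem4p4:
  fixes n :: nat
    and \<chi> :: "(int \<Rightarrow> int) \<Rightarrow> complex"
    and B :: "'b set" and sDes :: "'b \<Rightarrow> signed_set"
    and B' :: "'c set" and sDes' :: "'c \<Rightarrow> signed_set"
  assumes "is_character n \<chi>"
    and "finite B" and "finite B'"
    and "fine_set n \<chi> B sDes"
    and "fine_set n \<chi> B' sDes'"
  shows "\<forall>\<sigma> \<in> signed_sets n. card {b \<in> B. sDes b = \<sigma>} = card {b \<in> B'. sDes' b = \<sigma>}"
proof
  fix \<sigma> assume \<sigma>: "\<sigma> \<in> signed_sets n"
  have maps: "sDes \<in> B \<rightarrow> signed_sets n" "sDes' \<in> B' \<rightarrow> signed_sets n"
    using assms(4,5) by (simp_all add: fine_set_def)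
  have "(\<Sum>b\<in>B. wt \<gamma> (sDes b)) = (\<Sum>b\<in>B'. wt \<gamma> (sDes' b))" if \<gamma>: "\<gamma> \<in> signed_compositions n" for \<gamma>
  proof -
    obtain w where w: "w \<in> hyperoctahedral n" "signed_cycle_type n w = composition_type \<gamma>"
      using exists_signed_cycle_type[OF \<gamma>] by blast
    show ?thesis
      using fine_set_sum_wt[OF assms(4) \<gamma> w] fine_set_sum_wt[OF assms(5) \<gamma> w]
      by (metis of_int_eq_iff)
  qed
  then show "card {b \<in> B. sDes b = \<sigma>} = card {b \<in> B'. sDes' b = \<sigma>}"
    using assms(2,3) maps \<sigma> by (intro weights_determine_distribution)
qed

end
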